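(* Let $a_i,b_i\in\mathbb{R}^3$ and $\sigma_i>0$ for $i=1,\dots,N$, and let $\bar c^2$ be a given constant. The mixed-integer program $$\min_{q\in S^3,\ \theta_i\in\{+1,-1\}}\ \sum_{i=1}^N \frac{1+\theta_i}{2}\,\frac{\|\hat b_i-q\otimes\hat a_i\otimes q^{-1}\|^2}{\sigma_i^2}+\frac{1-\theta_i}{2}\bar c^2$$ is equivalent, in the sense that they admit the same optimal solution $q$, to the optimization problem $$\min_{q\in S^3,\ q_i\in\{+q,-q\}}\ \sum_{i=1}^N \frac{\|\hat b_i-q\otimes\hat a_i\otimes q^{-1}+q^{\mathsf T}q_i\,\hat b_i-q\otimes\hat a_i\otimes q_i^{-1}\|^2}{4\sigma_i^2}+\frac{1-q^{\mathsf T}q_i}{2}\bar c^2,$$ which involves the $N+1$ quaternions $q,q_1,\dots,q_N$. (Here $\theta_i$, respectively $q_i$, ranges over the indicated set for each $i=1,\dots,N$; "same optimal solution $q$" means that a unit quaternion $q$ is the $q$-component of a minimizer of the first problem if and only if it is the $q$-component of a minimizer of the second.)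
   Context: A quaternion is a column vector $q=[q_1\ q_2\ q_3\ q_4]^{\mathsf T}=[v^{\mathsf T}\ s]^{\mathsf T}\in\mathbb{R}^4$ with vector part $v\in\mathbb{R}^3$ and scalar part $s=q_4$ (last entry). $S^3=\{q\in\mathbb{R}^4:\|q\|=1\}$ is the set of unit quaternions. For $q\in\mathbb{R}^4$ define $$\Omega_1(q)=\begin{bmatrix} q_4&-q_3&q_2&q_1\\ q_3&q_4&-q_1&q_2\\ -q_2&q_1&q_4&q_3\\ -q_1&-q_2&-q_3&q_4\end{bmatrix},\qquad \Omega_2(q)=\begin{bmatrix} q_4&q_3&-q_2&q_1\\ -q_3&q_4&q_1&q_2\\ q_2&-q_1&q_4&q_3\\ -q_1&-q_2&-q_3&q_4\end{bmatrix}.$$ The quaternion product is $p\otimes q=\Omega_1(p)q=\Omega_2(q)p$. The inverse of a unit quaternion $q=[v^{\mathsf T}\ s]^{\mathsf T}$ is $q^{-1}=[-v^{\mathsf T}\ s]^{\mathsf T}$. For $a\in\mathbb{R}^3$, $\hat a=[a^{\mathsf T}\ 0]^{\mathsf T}\in\mathbb{R}^4$. Norms are Euclidean. In $q_i$ with $i$ indexing measurements, $q_i\in\mathbb{R}^4$ denotes a quaternion (not an entry). *)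

theory Defs
  imports "HOL-Analysis.Analysis"
begin

text \<open>Quaternions are vectors in \<open>\<real>\<^sup>4\<close> with the scalar part in the last entry.\<close>

definition Omega1 :: "real^4 \<Rightarrow> real^4^4" where
  "Omega1 q = vector [
     vector [  q$4, - q$3,   q$2, q$1],
     vector [  q$3,   q$4, - q$1, q$2],
     vector [- q$2,   q$1,   q$4, q$3],
     vector [- q$1, - q$2, - q$3, q$4]]"

definition Omega2 :: "real^4 \<Rightarrow> real^4^4" where
  "Omega2 q = vector [
     vector [  q$4,   q$3, - q$2, q$1],
     vector [- q$3,   q$4,   q$1, q$2],
     vector [  q$2, - q$1,   q$4, q$3],
     vector [- q$1, - q$2, - q$3, q$4]]"

definition quat_mult :: "real^4 \<Rightarrow> real^4 \<Rightarrow> real^4"  (infixl "\<otimes>\<^sub>q" 70) where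
  "p \<otimes>\<^sub>q q = Omega1 p *v q"

text \<open>This is the inverse only for unit quaternions, and is only used for those.\<close>

definition quat_inv :: "real^4 \<Rightarrow> real^4" where
  "quat_inv q = vector [- q$1, - q$2, - q$3, q$4]"

definition quat_hat :: "real^3 \<Rightarrow> real^4" where
  "quat_hat a = vector [a$1, a$2, a$3, 0]"

abbreviation unit_quats :: "(real^4) set" where
  "unit_quats \<equiv> sphere 0 1"

lemma vector_4 [simp]:
  "(vector [w, x, y, z] :: 'a::zero^4) $ 1 = w"
  "(vector [w, x, y, z] :: 'a::zero^4) $ 2 = x"
  "(vector [w, x, y, z] :: 'a::zero^4) $ 3 = y"
  "(vector [w, x, y, z] :: 'a::zero^4) $ 4 = z"
  unfolding vector_def by simp_all

lemma quat_mult_Omega2: "p \<otimes>\<^sub>q q = Omega2 q *v p"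
  unfolding quat_mult_def Omega1_def Omega2_def
  by (simp add: vec_eq_iff matrix_vector_mult_def forall_4 sum_4 algebra_simps)

lemma quat_inv_left_right:
  assumes "q \<in> unit_quats"
  shows "quat_inv q \<otimes>\<^sub>q q = vector [0, 0, 0, 1]" "q \<otimes>\<^sub>q quat_inv q = vector [0, 0, 0, 1]"
proof -
  have "q$1 * q$1 + q$2 * q$2 + q$3 * q$3 + q$4 * q$4 = 1"
    using assms by (simp add: norm_eq_1 inner_vec_def sum_4)
  then show "quat_inv q \<otimes>\<^sub>q q = vector [0, 0, 0, 1]" "q \<otimes>\<^sub>q quat_inv q = vector [0, 0, 0, 1]"
    unfolding quat_mult_def Omega1_def quat_inv_def
    by (simp_all add: vec_eq_iff matrix_vector_mult_def forall_4 sum_4 algebra_simps)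
qed

text \<open>Tuples indexed by \<open>1,\<dots>,N\<close> are functions in \<open>\<Pi>\<^sub>E i\<in>{1..N}. _\<close>.\<close>

definition mip_feasible :: "nat \<Rightarrow> ((real^4) \<times> (nat \<Rightarrow> real)) set" where
  "mip_feasible N = {(q, \<theta>). q \<in> unit_quats \<and> \<theta> \<in> (\<Pi>\<^sub>E i\<in>{1..N}. {1, -1})}"

definition mip_cost ::
  "nat \<Rightarrow> (nat \<Rightarrow> real^3) \<Rightarrow> (nat \<Rightarrow> real^3) \<Rightarrow> (nat \<Rightarrow> real) \<Rightarrow> real
     \<Rightarrow> (real^4) \<times> (nat \<Rightarrow> real) \<Rightarrow> real" where
  "mip_cost N a b \<sigma> c = (\<lambda>(q, \<theta>). \<Sum>i=1..N.
     (1 + \<theta> i) / 2 *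
       ((norm (quat_hat (b i) - q \<otimes>\<^sub>q quat_hat (a i) \<otimes>\<^sub>q quat_inv q))\<^sup>2 / (\<sigma> i)\<^sup>2)
     + (1 - \<theta> i) / 2 * c\<^sup>2)"

definition quat_feasible :: "nat \<Rightarrow> ((real^4) \<times> (nat \<Rightarrow> real^4)) set" where
  "quat_feasible N = {(q, Q). q \<in> unit_quats \<and> Q \<in> (\<Pi>\<^sub>E i\<in>{1..N}. {q, -q})}"

definition quat_cost ::
  "nat \<Rightarrow> (nat \<Rightarrow> real^3) \<Rightarrow> (nat \<Rightarrow> real^3) \<Rightarrow> (nat \<Rightarrow> real) \<Rightarrow> real
     \<Rightarrow> (real^4) \<times> (nat \<Rightarrow> real^4) \<Rightarrow> real" where
  "quat_cost N a b \<sigma> c = (\<lambda>(q, Q). \<Sum>i=1..N.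
     (norm (quat_hat (b i) - q \<otimes>\<^sub>q quat_hat (a i) \<otimes>\<^sub>q quat_inv q
            + (q \<bullet> Q i) *\<^sub>R quat_hat (b i) - q \<otimes>\<^sub>q quat_hat (a i) \<otimes>\<^sub>q quat_inv (Q i)))\<^sup>2
       / (4 * (\<sigma> i)\<^sup>2)
     + (1 - q \<bullet> Q i) / 2 * c\<^sup>2)"

end

theory Submission
  imports Defs
begin

text \<open>
  Writing \<open>q\<^sub>i = \<theta>\<^sub>i q\<close> identifies the two feasible sets over each fixed \<open>q\<close>. For unit \<open>q\<close> this
  gives \<open>q \<bullet> q\<^sub>i = \<theta>\<^sub>i\<close>, so the vector in the \<open>i\<close>-th term of the second cost is \<open>1 + \<theta>\<^sub>i\<close> times
  the residual in the first. Since \<open>\<theta>\<^sub>i\<^sup>2 = 1\<close> implies \<open>(1 + \<theta>\<^sub>i)\<^sup>2 / 4 = (1 + \<theta>\<^sub>i) / 2\<close>, the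
  identification preserves the cost.
\<close>

text \<open>Each competitor in the image is \<open>F y\<close> for some \<open>y\<close> in
  \<open>A\<close> and costs \<open>f y\<close>, so a strictly better one exists on one side exactly
  when it exists on the other.\<close>

lemma is_arg_min_image:
  assumes "\<And>x. x \<in> A \<Longrightarrow> g (F x) = f x" and "x \<in> A"
  shows "is_arg_min g (\<lambda>y. y \<in> F ` A) (F x) \<longleftrightarrow> is_arg_min f (\<lambda>x. x \<in> A) x"
  using assms by (auto simp: is_arg_min_def)

lemma quat_inv_scaleR: "quat_inv (t *\<^sub>R q) = t *\<^sub>R quat_inv q"
  by (simp add: quat_inv_def vec_eq_iff forall_4)

lemma quat_mult_scaleR_right: "p \<otimes>\<^sub>q (t *\<^sub>R q) = t *\<^sub>R (p \<otimes>\<^sub>q q)"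
  by (simp add: quat_mult_def matrix_vector_mult_scaleR)

text \<open>The restriction makes the tuple \<open>undefined\<close> outside \<open>{1..N}\<close>,
  as the extensional product in \<open>quat_feasible\<close> demands.\<close>

definition sign_to_quat :: "nat \<Rightarrow> (real^4) \<times> (nat \<Rightarrow> real) \<Rightarrow> (real^4) \<times> (nat \<Rightarrow> real^4)" where
  "sign_to_quat N = (\<lambda>(q, \<theta>). (q, \<lambda>i\<in>{1..N}. \<theta> i *\<^sub>R q))"

lemma sign_to_quat_image: "sign_to_quat N ` mip_feasible N = quat_feasible N"
proof
  show "sign_to_quat N ` mip_feasible N \<subseteq> quat_feasible N"
    by (fastforce simp: sign_to_quat_def mip_feasible_def quat_feasible_def PiE_iff)
  show "quat_feasible N \<subseteq> sign_to_quat N ` mip_feasible N"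
  proof
    fix z assume "z \<in> quat_feasible N"
    then obtain q Q where z: "z = (q, Q)" and q: "q \<in> unit_quats"
      and Q: "Q \<in> (\<Pi>\<^sub>E i\<in>{1..N}. {q, -q})"
      by (auto simp: quat_feasible_def)
    \<comment> \<open>Feasibility leaves only \<open>Q i = -q\<close> in the else branch, so this
      choice recovers the sign.\<close>
    define \<theta> where "\<theta> = (\<lambda>i\<in>{1..N}. if Q i = q then 1 else -1 :: real)"
    have "\<theta> \<in> (\<Pi>\<^sub>E i\<in>{1..N}. {1, -1})"
      by (auto simp: \<theta>_def)
    moreover have "Q = (\<lambda>i\<in>{1..N}. \<theta> i *\<^sub>R q)"
      using Q by (fastforce simp: \<theta>_def PiE_iff extensional_def)
    ultimately show "z \<in> sign_to_quat N ` mip_feasible N"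
      using q by (force simp: z sign_to_quat_def mip_feasible_def)
  qed
qed

lemma quat_cost_sign_to_quat:
  assumes "x \<in> mip_feasible N"
  shows "quat_cost N a b \<sigma> c (sign_to_quat N x) = mip_cost N a b \<sigma> c x"
proof -
  obtain q \<theta> where x: "x = (q, \<theta>)" and q: "q \<in> unit_quats"
    and \<theta>: "\<theta> \<in> (\<Pi>\<^sub>E i\<in>{1..N}. {1, -1})"
    using assms by (auto simp: mip_feasible_def)
  \<comment> \<open>Generic \<open>v\<close>, \<open>w\<close>, \<open>t\<close>, \<open>s\<close>
    let this serve below as a rewrite rule for every summand.\<close>
  have term_eq:
    "(norm (v - q \<otimes>\<^sub>q w \<otimes>\<^sub>q quat_inv q + (q \<bullet> t *\<^sub>R q) *\<^sub>R v
            - q \<otimes>\<^sub>q w \<otimes>\<^sub>q quat_inv (t *\<^sub>R q)))\<^sup>2 / (4 * s\<^sup>2) + (1 - q \<bullet> t *\<^sub>R q) / 2 * c\<^sup>2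
     = (1 + t) / 2 * ((norm (v - q \<otimes>\<^sub>q w \<otimes>\<^sub>q quat_inv q))\<^sup>2 / s\<^sup>2) + (1 - t) / 2 * c\<^sup>2"
    if "t \<in> {1, -1}" for t s :: real and v w
  proof -
    have inner: "q \<bullet> t *\<^sub>R q = t"
      using q by (simp add: norm_eq_1)
    have "v - q \<otimes>\<^sub>q w \<otimes>\<^sub>q quat_inv q + t *\<^sub>R v - q \<otimes>\<^sub>q w \<otimes>\<^sub>q quat_inv (t *\<^sub>R q)
          = (1 + t) *\<^sub>R (v - q \<otimes>\<^sub>q w \<otimes>\<^sub>q quat_inv q)"
      by (simp add: quat_inv_scaleR quat_mult_scaleR_right algebra_simps)
    moreover have "(1 + t)\<^sup>2 = 2 * (1 + t)"
      using that by auto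
    ultimately show ?thesis
      unfolding inner by (simp add: power_mult_distrib add_divide_distrib distrib_right)
  qed
  have "\<theta> i \<in> {1, -1}" if "i \<in> {1..N}" for i
    using \<theta> that by (rule PiE_mem)
  then show ?thesis
    unfolding x sign_to_quat_def quat_cost_def mip_cost_def prod.case
    \<comment> \<open>\<open>sum.cong\<close> supplies the index membership that removes the
      restriction; \<open>simp only\<close> keeps the summand in the shape of
      \<open>term_eq\<close>.\<close>
    by (intro sum.cong refl) (simp only: restrict_apply' term_eq)
qed

theorem proposition3:
  fixes N :: nat and a b :: "nat \<Rightarrow> real^3" and \<sigma> :: "nat \<Rightarrow> real" and c :: real
    and q :: "real^4"
  assumes "\<And>i. i \<in> {1..N} \<Longrightarrow> \<sigma> i > 0"
  shows "(\<exists>\<theta>. is_arg_min (mip_cost N a b \<sigma> c) (\<lambda>x. x \<in> mip_feasible N) (q, \<theta>)) \<longleftrightarrow>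
         (\<exists>Q. is_arg_min (quat_cost N a b \<sigma> c) (\<lambda>x. x \<in> quat_feasible N) (q, Q))"
    (is "?L \<longleftrightarrow> ?R")
proof -
  have transfer: "is_arg_min (quat_cost N a b \<sigma> c) (\<lambda>y. y \<in> quat_feasible N) (sign_to_quat N x)
      \<longleftrightarrow> is_arg_min (mip_cost N a b \<sigma> c) (\<lambda>x. x \<in> mip_feasible N) x"
    if "x \<in> mip_feasible N" for x
    unfolding sign_to_quat_image[symmetric]
    by (rule is_arg_min_image[OF _ that]) (rule quat_cost_sign_to_quat)
  show ?thesis
  proof
    assume ?L
    then obtain \<theta> where \<theta>: "is_arg_min (mip_cost N a b \<sigma> c) (\<lambda>x. x \<in> mip_feasible N) (q, \<theta>)" ..
    then have "(q, \<theta>) \<in> mip_feasible N"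
      by (simp add: is_arg_min_def)
    then show ?R
      using \<theta> transfer by (fastforce simp: sign_to_quat_def)
  next
    assume ?R
    then obtain Q where Q: "is_arg_min (quat_cost N a b \<sigma> c) (\<lambda>x. x \<in> quat_feasible N) (q, Q)" ..
    then have "(q, Q) \<in> sign_to_quat N ` mip_feasible N"
      by (simp add: is_arg_min_def sign_to_quat_image)
    \<comment> \<open>A preimage of \<open>(q, Q)\<close> has the same \<open>q\<close>, since
      \<open>sign_to_quat\<close> fixes the first component.\<close>
    then obtain \<theta> where "(q, \<theta>) \<in> mip_feasible N" "sign_to_quat N (q, \<theta>) = (q, Q)"
      by (auto simp: sign_to_quat_def)
    then show ?L
      using Q transfer by metis
  qed
qed

end
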